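(* Let $\Omega:=\{(x,y)\in\mathbb{R}^m\times\mathbb{R}^m \mid x\in\mathcal{K},\ y\in\mathcal{K},\ x^Ty=0\}$, where $\mathcal{K}$ is the $m$-dimensional second-order cone, and let $(x,y)\in\Omega$. Then the regular normal cone of $\Omega$ at $(x,y)$ is $$ \widehat{N}_\Omega(x,y)=\begin{cases} \{(u,v)\mid u\in\mathbb{R}^m,\ v=0\} & \text{if } x=0,\ y\in\operatorname{int}\mathcal{K};\\ \{(u,v)\mid u=0,\ v\in\mathbb{R}^m\} & \text{if } x\in\operatorname{int}\mathcal{K},\ y=0;\\ \{(u,v)\mid u\perp x,\ v\perp y,\ x_1\hat{u}+y_1v\in\mathbb{R}x\} & \text{if } x,y\in\operatorname{bd}\mathcal{K}\setminus\{0\},\ x^Ty=0;\\ \{(u,v)\mid u\in\hat{y}^\circ,\ v\in\mathbb{R}_-\hat{y}\} & \text{if } x=0,\ y\in\operatorname{bd}\mathcal{K}\setminus\{0\};\\ \{(u,v)\mid u\in\mathbb{R}_-\hat{x},\ v\in\hat{x}^\circ\} & \text{if } x\in\operatorname{bd}\mathcal{K}\setminus\{0\},\ y=0;\\ \{(u,v)\mid u\in-\mathcal{K},\ v\in-\mathcal{K}\} & \text{if } x=0,\ y=0, \end{cases} $$ where in every case $(u,v)$ ranges over $\mathbb{R}^m\times\mathbb{R}^m$.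
   Context: Vectors of $\mathbb{R}^m$ are written $x=(x_1,x_2)\in\mathbb{R}\times\mathbb{R}^{m-1}$; $\|\cdot\|$ is the Euclidean norm. The second-order cone is $\mathcal{K}:=\{(x_1,x_2)\in\mathbb{R}\times\mathbb{R}^{m-1}\mid x_1\ge\|x_2\|\}$, with $\operatorname{int}\mathcal{K}=\{x\mid x_1>\|x_2\|\}$ and $\operatorname{bd}\mathcal{K}=\{x\mid x_1=\|x_2\|\}$. For $x=(x_1,x_2)$, the reflection is $\hat{x}:=(x_1,-x_2)$. For a vector $x$, $\mathbb{R}x:=\{tx\mid t\in\mathbb{R}\}$ and $\mathbb{R}_-x:=\{tx\mid t\le 0\}$. For a vector $v$, $v^\circ:=\{x\mid x^Tv\le 0\}$. For $C\subset\mathbb{R}^n$ and $x^*\in\operatorname{cl}C$, the regular (Fréchet) normal cone is $\widehat{N}_C(x^* ):=\{v\in\mathbb{R}^n\mid \langle v,x-x^*\rangle\le o(\|x-x^*\|)\ \ \forall x\in C\}$, i.e. $v\in\widehat{N}_C(x^* )$ iff $\limsup_{x\to x^*,\,x\in C,\,x\ne x^*}\langle v,x-x^*\rangle/\|x-x^*\|\le 0$. *)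

theory Defs
  imports "HOL-Analysis.Analysis"
begin

text \<open>
  The splitting \<open>x = (x\<^sub>1, x\<^sub>2)\<close> of a vector of \<open>\<real>\<^sup>m\<close> (m \<open>\<ge>\<close> 1) is encoded by a
  distinguished index \<open>k :: 'm\<close>: the head \<open>x\<^sub>1\<close> is \<open>x $ k\<close>, and the tail \<open>x\<^sub>2\<close> consists of the
  other coordinates.  The tail is kept in the same space, padded with 0 at \<open>k\<close>, which leaves
  its Euclidean norm unchanged.  Unlike \<open>real \<times> real ^ 'n\<close>, this includes m = 1.
\<close>

definition soc_tail :: "'m::finite \<Rightarrow> real ^ 'm \<Rightarrow> real ^ 'm" where
  "soc_tail k x = (\<chi> j. if j = k then 0 else x $ j)"

definition soc :: "'m::finite \<Rightarrow> (real ^ 'm) set" where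
  "soc k = {x. x $ k \<ge> norm (soc_tail k x)}"

definition soc_reflect :: "'m::finite \<Rightarrow> real ^ 'm \<Rightarrow> real ^ 'm" where
  "soc_reflect k x = (\<chi> j. if j = k then x $ j else - (x $ j))"

definition soc_compl :: "'m::finite \<Rightarrow> ((real ^ 'm) \<times> (real ^ 'm)) set" where
  "soc_compl k = {(x, y). x \<in> soc k \<and> y \<in> soc k \<and> x \<bullet> y = 0}"

definition scalar_line :: "'a::real_vector \<Rightarrow> 'a set" where
  "scalar_line x = {t *\<^sub>R x | t. True}"

definition nonpos_ray :: "'a::real_vector \<Rightarrow> 'a set" where
  "nonpos_ray x = {t *\<^sub>R x | t. t \<le> 0}"

definition vec_polar :: "'a::real_inner \<Rightarrow> 'a set" where
  "vec_polar v = {x. x \<bullet> v \<le> 0}"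

text \<open>
  The upper limit is that of the punctured filter \<open>at x within C\<close>; at an isolated point of \<open>C\<close>
  it is \<open>-\<infinity>\<close>, so the cone is the whole space there.  Meaningful only for \<open>x \<in> closure C\<close>.
\<close>

definition regular_normal_cone :: "'a::real_inner set \<Rightarrow> 'a \<Rightarrow> 'a set" where
  "regular_normal_cone C x =
     {v. Limsup (at x within C) (\<lambda>z. ereal ((v \<bullet> (z - x)) / norm (z - x))) \<le> 0}"

lemma regular_normal_cone_iff:
  "v \<in> regular_normal_cone C x \<longleftrightarrow>
     (\<forall>e>0. \<forall>\<^sub>F z in at x within C. v \<bullet> (z - x) \<le> e * norm (z - x))"
proof -
  let ?F = "at x within C"
  let ?q = "\<lambda>z. (v \<bullet> (z - x)) / norm (z - x)"
  have ne: "\<forall>\<^sub>F z in ?F. z \<noteq> x"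
    by (simp add: eventually_at_filter)
  have le: "(\<forall>\<^sub>F z in ?F. v \<bullet> (z - x) \<le> e * norm (z - x)) \<longleftrightarrow> (\<forall>\<^sub>F z in ?F. ?q z \<le> e)" for e
    by (rule eventually_subst, rule eventually_mono[OF ne]) (simp add: pos_divide_le_eq)
  have "Limsup ?F (\<lambda>z. ereal (?q z)) \<le> 0 \<longleftrightarrow> (\<forall>e>0. \<forall>\<^sub>F z in ?F. ?q z \<le> e)"
  proof
    assume L: "Limsup ?F (\<lambda>z. ereal (?q z)) \<le> 0"
    show "\<forall>e>0. \<forall>\<^sub>F z in ?F. ?q z \<le> e"
    proof (intro allI impI)
      fix e :: real assume "e > 0"
      then have "\<forall>\<^sub>F z in ?F. ereal (?q z) < ereal e"
        using L[unfolded Limsup_le_iff, rule_format, of "ereal e"] by simp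
      then show "\<forall>\<^sub>F z in ?F. ?q z \<le> e"
        by (rule eventually_mono) simp
    qed
  next
    assume R: "\<forall>e>0. \<forall>\<^sub>F z in ?F. ?q z \<le> e"
    have "Limsup ?F (\<lambda>z. ereal (?q z)) \<le> 0 + ereal e" if "e > 0" for e
      using R that by (auto intro!: Limsup_bounded)
    then show "Limsup ?F (\<lambda>z. ereal (?q z)) \<le> 0"
      by (rule ereal_le_epsilon2[rule_format])
  qed
  then show ?thesis
    unfolding regular_normal_cone_def by (simp add: le)
qed

lemma continuous_on_soc_gap: "continuous_on UNIV (\<lambda>x. x $ k - norm (soc_tail k x))"
proof -
  have "soc_tail k = (\<lambda>x. x - (x $ k) *\<^sub>R axis k 1)"
    by (auto simp: soc_tail_def fun_eq_iff vec_eq_iff axis_def)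
  then show ?thesis
    by (auto intro!: continuous_intros)
qed

lemma closed_soc: "closed (soc k)"
proof -
  have "closed {x. 0 \<le> x $ k - norm (soc_tail k x)}"
    by (rule closed_Collect_le) (use continuous_on_soc_gap in auto)
  then show ?thesis by (simp add: soc_def)
qed

lemma interior_soc: "interior (soc k) = {x. x $ k > norm (soc_tail k x)}"
proof
  have "open {x. 0 < x $ k - norm (soc_tail k x)}"
    by (rule open_Collect_less) (use continuous_on_soc_gap in auto)
  then have "open {x. x $ k > norm (soc_tail k x)}" by simp
  then show "{x. x $ k > norm (soc_tail k x)} \<subseteq> interior (soc k)"
    by (intro interior_maximal) (auto simp: soc_def)
  show "interior (soc k) \<subseteq> {x. x $ k > norm (soc_tail k x)}"
  proof
    fix x assume "x \<in> interior (soc k)"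
    then obtain e where e: "e > 0" "cball x e \<subseteq> soc k"
      by (auto simp: mem_interior_cball)
    let ?z = "x - e *\<^sub>R axis k 1"
    have "?z \<in> cball x e" using e by (simp add: dist_norm)
    then have "?z \<in> soc k" using e by blast
    moreover have "soc_tail k ?z = soc_tail k x"
      by (auto simp: soc_tail_def vec_eq_iff axis_def)
    ultimately show "x \<in> {x. x $ k > norm (soc_tail k x)}"
      using e by (simp add: soc_def)
  qed
qed

lemma frontier_soc: "frontier (soc k) = {x. x $ k = norm (soc_tail k x)}"
  unfolding frontier_def interior_soc closure_closed[OF closed_soc] by (auto simp: soc_def)

end

theory Submission
  imports Defs
begin

text \<open>
  Write \<open>\<rho>\<close> for the reflection and call \<open>z \<bullet> \<rho> z\<close> the Lorentz form; it is the square of the head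
  minus the square of the norm of the tail.  The cone \<open>\<K>\<close> is the set where the head and the form are
  nonnegative, its interior is where both are positive, and its boundary consists of the null
  vectors of the form with nonnegative head.  Since \<open>\<rho>\<close> is a self-adjoint isometric involution,
  every computation below is bilinear algebra.

  The key fact (\<open>soc_complementary_parallel\<close>) is that complementary vectors satisfy
  \<open>y\<^sub>1 x = x\<^sub>1 \<rho> y\<close>: the difference of the two sides has head zero, so its form is minus its squared
  norm, while bilinearity and \<open>x \<bullet> y = 0\<close> show that its form is nonnegative.  Consequently, two
  nonzero complementary vectors are null vectors, each a positive multiple of the reflection of the
  other, and the complement of an interior vector is 0.  This describes the complementarity set
  \<open>\<Omega>\<close> near each of its points: near \<open>(0, y)\<close> with \<open>y\<close> interior it is \<open>{0} \<times> \<K>\<close>; near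
  \<open>(0, y)\<close> with \<open>y \<noteq> 0\<close> on the boundary its points are \<open>(s \<rho> b, b)\<close> with \<open>s \<ge> 0\<close>; near
  a pair of nonzero vectors it is the manifold of the pairs \<open>(a, c \<rho> a)\<close> with \<open>a\<close> null.

  That normals satisfy the stated conditions is shown by testing them against curves in \<open>\<Omega>\<close>
  (\<open>regular_normal_cone_tangent\<close>); quadratic curves suffice, because subtracting a suitable multiple
  \<open>s t\<^sup>2\<close> of \<open>\<rho> z\<close> makes \<open>z + t d\<close> exactly null when \<open>d\<close> is orthogonal to \<open>z\<close> and \<open>\<rho> z\<close>
  (\<open>frontier_soc_curve\<close>).  Testing with these \<open>d\<close> forces a vector orthogonal to \<open>z\<close> to be a
  multiple of \<open>\<rho> z\<close> (\<open>multiple_of_reflect\<close>).  Conversely, the parametrisations of \<open>\<Omega>\<close> turn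
  \<open>(u, v) \<bullet> (p - z)\<close> into an explicit expression bounded by \<open>r p * norm (p - z)\<close> with
  \<open>r p \<rightarrow> 0\<close> (\<open>regular_normal_coneI\<close>).  At the origin, \<open>\<Omega>\<close> contains \<open>\<K> \<times> {0}\<close> and
  \<open>{0} \<times> \<K>\<close>, and the claim is the self-duality of \<open>\<K>\<close>.  The two cases with \<open>y = 0 \<noteq> x\<close>
  follow by exchanging the two factors.
\<close>

section \<open>Reflection and the Lorentz form\<close>

lemma inner_self_nonpos: "a \<bullet> a \<le> 0 \<longleftrightarrow> a = 0"
  by (metis inner_eq_zero_iff inner_ge_zero order_antisym order_refl)

lemma soc_reflect_nth: "soc_reflect k z $ k = z $ k"
  by (simp add: soc_reflect_def)

lemma soc_reflect_linear:
  "soc_reflect k (a + b) = soc_reflect k a + soc_reflect k b"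
  "soc_reflect k (a - b) = soc_reflect k a - soc_reflect k b"
  "soc_reflect k (c *\<^sub>R a) = c *\<^sub>R soc_reflect k a"
  by (simp_all add: soc_reflect_def vec_eq_iff)

lemma soc_reflect_soc_reflect [simp]: "soc_reflect k (soc_reflect k z) = z"
  by (simp add: soc_reflect_def vec_eq_iff)

lemma inner_soc_reflect_commute: "soc_reflect k a \<bullet> b = a \<bullet> soc_reflect k b"
  by (auto simp: soc_reflect_def inner_vec_def intro!: sum.cong)

lemma norm_soc_reflect [simp]: "norm (soc_reflect k z) = norm z"
  by (simp add: norm_eq_sqrt_inner inner_soc_reflect_commute)

lemma inner_eq_head_tail: "a \<bullet> b = a $ k * b $ k + soc_tail k a \<bullet> soc_tail k b"
proof -
  have "soc_tail k a \<bullet> soc_tail k b = (\<Sum>i\<in>UNIV - {k}. a $ i * b $ i)"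
    unfolding inner_vec_def soc_tail_def
    by (rule sum.mono_neutral_cong_right) auto
  then show ?thesis
    by (simp add: inner_vec_def sum.remove[of UNIV k])
qed

lemma lorentz_form_eq: "z \<bullet> soc_reflect k z = (z $ k)\<^sup>2 - (norm (soc_tail k z))\<^sup>2"
proof -
  have "soc_tail k (soc_reflect k z) = - soc_tail k z"
    by (simp add: soc_tail_def soc_reflect_def vec_eq_iff)
  then show ?thesis
    by (simp add: inner_eq_head_tail[of z _ k] soc_reflect_nth power2_eq_square
        flip: power2_norm_eq_inner)
qed

text \<open>The form is negative definite on the hyperplane of head zero, so a vector there with
  nonnegative form must vanish.\<close>
lemma lorentz_form_head_zero:
  assumes "z $ k = 0"
  shows "z \<bullet> soc_reflect k z = - (z \<bullet> z)"
  using assms inner_eq_head_tail[of z z k]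
  by (simp add: lorentz_form_eq power2_norm_eq_inner)

lemma soc_iff: "z \<in> soc k \<longleftrightarrow> 0 \<le> z $ k \<and> 0 \<le> z \<bullet> soc_reflect k z"
proof -
  have "norm (soc_tail k z) \<le> z $ k \<longleftrightarrow> 0 \<le> z $ k \<and> (norm (soc_tail k z))\<^sup>2 \<le> (z $ k)\<^sup>2"
    by (smt (verit) norm_ge_zero power2_le_imp_le power_mono)
  then show ?thesis
    by (simp add: soc_def lorentz_form_eq)
qed

lemma interior_soc_iff: "z \<in> interior (soc k) \<longleftrightarrow> 0 < z $ k \<and> 0 < z \<bullet> soc_reflect k z"
proof -
  have "norm (soc_tail k z) < z $ k \<longleftrightarrow> 0 < z $ k \<and> (norm (soc_tail k z))\<^sup>2 < (z $ k)\<^sup>2"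
    by (smt (verit) norm_ge_zero power_less_imp_less_base power_strict_mono zero_less_numeral)
  then show ?thesis
    by (simp add: interior_soc lorentz_form_eq)
qed

lemma frontier_soc_iff: "z \<in> frontier (soc k) \<longleftrightarrow> 0 \<le> z $ k \<and> z \<bullet> soc_reflect k z = 0"
proof -
  have "z $ k = norm (soc_tail k z) \<longleftrightarrow> 0 \<le> z $ k \<and> (norm (soc_tail k z))\<^sup>2 = (z $ k)\<^sup>2"
    by (smt (verit) norm_ge_zero power2_eq_iff_nonneg)
  then show ?thesis
    unfolding frontier_soc lorentz_form_eq mem_Collect_eq by linarith
qed

lemma soc_head_pos:
  assumes "z \<in> soc k" "z \<noteq> 0"
  shows "0 < z $ k"
proof (rule ccontr)
  assume "\<not> ?thesis"
  with assms(1) have "z $ k = 0" "0 \<le> z \<bullet> soc_reflect k z"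
    by (auto simp: soc_iff)
  then have "z \<bullet> z \<le> 0"
    using lorentz_form_head_zero[of z k] by simp
  with assms(2) show False
    by (simp add: inner_self_nonpos)
qed

lemma zero_in_soc: "0 \<in> soc k"
  by (simp add: soc_iff soc_reflect_def)

lemma scaleR_in_soc: "z \<in> soc k \<Longrightarrow> 0 \<le> c \<Longrightarrow> c *\<^sub>R z \<in> soc k"
  by (simp add: soc_iff soc_reflect_linear)

lemma soc_reflect_in_soc: "soc_reflect k z \<in> soc k \<longleftrightarrow> z \<in> soc k"
  by (simp add: soc_iff soc_reflect_nth inner_soc_reflect_commute inner_commute)

lemma frontier_subset_soc: "z \<in> frontier (soc k) \<Longrightarrow> z \<in> soc k"
  by (simp add: frontier_soc_iff soc_iff)

lemma soc_interior_or_frontier: "z \<in> soc k \<Longrightarrow> z \<in> interior (soc k) \<or> z \<in> frontier (soc k)"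
  using soc_head_pos[of z k] by (cases "z = 0") (auto simp: soc_iff interior_soc_iff frontier_soc_iff)

lemma inner_soc_nonneg:
  assumes "x \<in> soc k" "y \<in> soc k"
  shows "0 \<le> x \<bullet> y"
proof -
  have "- (soc_tail k x \<bullet> soc_tail k y) \<le> norm (soc_tail k x) * norm (soc_tail k y)"
    using norm_cauchy_schwarz[of "- soc_tail k x" "soc_tail k y"] by simp
  also have "\<dots> \<le> x $ k * y $ k"
    using assms by (intro mult_mono) (auto simp: soc_def intro: order_trans[OF norm_ge_zero])
  finally show ?thesis
    by (simp add: inner_eq_head_tail[of x y k])
qed

text \<open>Self-duality of the cone.  If \<open>u\<close> pairs nonpositively with the cone, the test vector
  \<open>(norm u\<^sub>2, u\<^sub>2)\<close> decides membership of \<open>- u\<close> when the tail \<open>u\<^sub>2\<close> is nonzero, and the axis of the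
  cone decides it otherwise.\<close>
lemma soc_polar:
  "(\<forall>p\<in>soc k. u \<bullet> p \<le> 0) \<longleftrightarrow> - u \<in> soc k"
proof
  assume *: "\<forall>p\<in>soc k. u \<bullet> p \<le> 0"
  \<comment> \<open>Only the head of \<open>u\<close> is replaced, so that \<open>p\<close> lies on the boundary of the cone.\<close>
  define p where "p = soc_tail k u + norm (soc_tail k u) *\<^sub>R axis k 1"
  have tail_p: "soc_tail k p = soc_tail k u" and head_p: "p $ k = norm (soc_tail k u)"
    by (auto simp: p_def soc_tail_def axis_def vec_eq_iff)
  have "u $ k * norm (soc_tail k u) + (norm (soc_tail k u))\<^sup>2 \<le> 0"
    using *[rule_format, of p] tail_p head_p
    by (simp add: soc_def inner_eq_head_tail[of u p k] power2_norm_eq_inner)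
  then have "norm (soc_tail k u) * (u $ k + norm (soc_tail k u)) \<le> 0"
    by (simp add: algebra_simps power2_eq_square)
  moreover have "axis k 1 \<in> soc k"
    by (simp add: soc_def soc_tail_def axis_def norm_vec_def L2_set_def cong: if_cong)
  then have "u $ k \<le> 0"
    using * by (auto simp: inner_axis)
  ultimately have "norm (soc_tail k u) \<le> - u $ k"
    by (smt (verit) mult_pos_pos norm_ge_zero)
  moreover have "soc_tail k (- u) = - soc_tail k u"
    by (simp add: soc_tail_def vec_eq_iff)
  ultimately show "- u \<in> soc k"
    by (simp add: soc_def)
next
  assume "- u \<in> soc k"
  then show "\<forall>p\<in>soc k. u \<bullet> p \<le> 0"
    using inner_soc_nonneg[of "- u" k] by auto
qed

section \<open>Complementary pairs\<close>

text \<open>This replaces the discussion of equality in the Cauchy-Schwarz inequality for the tails: the mixed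
  term in the Lorentz form of the difference is a multiple of \<open>x \<bullet> y = 0\<close>.\<close>
lemma soc_complementary_parallel:
  assumes "x \<in> soc k" "y \<in> soc k" "x \<bullet> y = 0"
  shows "(y $ k) *\<^sub>R x = (x $ k) *\<^sub>R soc_reflect k y"
proof -
  define z where "z = (y $ k) *\<^sub>R x - (x $ k) *\<^sub>R soc_reflect k y"
  have "z \<bullet> soc_reflect k z =
      (y $ k)\<^sup>2 * (x \<bullet> soc_reflect k x) + (x $ k)\<^sup>2 * (y \<bullet> soc_reflect k y)"
    using assms(3)
    by (simp add: z_def soc_reflect_linear inner_diff_left inner_diff_right inner_commute
        inner_soc_reflect_commute power2_eq_square algebra_simps)
  also have "\<dots> \<ge> 0"
    using assms by (simp add: soc_iff)
  finally have "z \<bullet> z \<le> 0"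
    using lorentz_form_head_zero[of z k] by (simp add: z_def soc_reflect_nth)
  then show ?thesis by (simp add: z_def inner_self_nonpos)
qed

lemma soc_compl_iff: "(x, y) \<in> soc_compl k \<longleftrightarrow> x \<in> soc k \<and> y \<in> soc k \<and> x \<bullet> y = 0"
  by (simp add: soc_compl_def)

lemma soc_compl_swap: "(x, y) \<in> soc_compl k \<longleftrightarrow> (y, x) \<in> soc_compl k"
  by (auto simp: soc_compl_iff inner_commute)

lemma soc_compl_fst_eq:
  assumes "(x, y) \<in> soc_compl k" "y \<noteq> 0"
  shows "x = (x $ k / y $ k) *\<^sub>R soc_reflect k y"
proof -
  have "0 < y $ k"
    using assms soc_head_pos by (auto simp: soc_compl_iff)
  moreover have "(y $ k) *\<^sub>R x = (x $ k) *\<^sub>R soc_reflect k y"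
    using assms soc_complementary_parallel by (auto simp: soc_compl_iff)
  ultimately show ?thesis
    by (metis divide_inverse_commute less_irrefl scaleR_scaleR scaleR_one left_inverse)
qed

lemma soc_compl_snd_eq:
  assumes "(x, y) \<in> soc_compl k" "x \<noteq> 0"
  shows "y = (y $ k / x $ k) *\<^sub>R soc_reflect k x"
  using assms soc_compl_fst_eq soc_compl_swap by blast

text \<open>Pairing \<open>y\<^sub>1 x = x\<^sub>1 \<rho> y\<close> with \<open>y\<close> leaves \<open>x\<^sub>1 (y \<bullet> \<rho> y) = 0\<close>, and \<open>x\<^sub>1 > 0\<close>.\<close>
lemma soc_compl_frontier:
  assumes "(x, y) \<in> soc_compl k" "x \<noteq> 0"
  shows "y \<in> frontier (soc k)"
proof -
  have "(x $ k) * (y \<bullet> soc_reflect k y) = y \<bullet> ((y $ k) *\<^sub>R x)"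
    using assms soc_complementary_parallel[of x k y] by (simp add: soc_compl_iff)
  also have "\<dots> = 0"
    using assms by (simp add: soc_compl_iff inner_commute)
  finally show ?thesis
    using assms soc_head_pos[of x k] by (auto simp: soc_compl_iff frontier_soc_iff soc_iff)
qed

lemma soc_compl_interior:
  assumes "(x, y) \<in> soc_compl k" "y \<in> interior (soc k)"
  shows "x = 0"
  using assms soc_compl_frontier[of x y k] by (auto simp: frontier_def)

lemma soc_compl_axes:
  "z \<in> soc k \<Longrightarrow> (z, 0) \<in> soc_compl k" "z \<in> soc k \<Longrightarrow> (0, z) \<in> soc_compl k"
  by (simp_all add: soc_compl_iff zero_in_soc)

lemma soc_compl_reflect:
  assumes "p \<in> frontier (soc k)" "0 \<le> a" "0 \<le> b"
  shows "(a *\<^sub>R p, b *\<^sub>R soc_reflect k p) \<in> soc_compl k"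
  using assms
  by (simp add: soc_compl_iff frontier_soc_iff soc_iff soc_reflect_nth soc_reflect_linear
      inner_soc_reflect_commute inner_commute)

section \<open>Regular normals, tangent curves and remainder bounds\<close>

lemma regular_normal_coneI:
  assumes "(r \<longlongrightarrow> 0) (at z within C)"
    and "\<forall>\<^sub>F p in at z within C. v \<bullet> (p - z) \<le> r p * norm (p - z)"
  shows "v \<in> regular_normal_cone C z"
  unfolding regular_normal_cone_iff
proof (intro allI impI)
  fix e :: real assume "0 < e"
  then have "\<forall>\<^sub>F p in at z within C. r p < e"
    using assms(1) order_tendstoD(2) by blast
  with assms(2) show "\<forall>\<^sub>F p in at z within C. v \<bullet> (p - z) \<le> e * norm (p - z)"
  proof eventually_elim
    case (elim p)
    then show ?case
      by (smt (verit) mult_right_mono norm_ge_zero)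
  qed
qed

lemma mult_le_abs_mult: "\<bar>a\<bar> \<le> b \<Longrightarrow> c * a \<le> \<bar>c\<bar> * b" for a b c :: real
  using mult_left_mono[of "\<bar>a\<bar>" b "\<bar>c\<bar>"] abs_ge_self[of "c * a"] by (simp add: abs_mult)

text \<open>Dividing the defining inequality by \<open>t\<close> along the curve and letting \<open>t\<close> tend to 0 gives
  \<open>v \<bullet> w \<le> e * norm w\<close> for every \<open>e > 0\<close>.  The curve may return to \<open>z\<close>, where the inequality holds
  trivially.\<close>
lemma regular_normal_cone_tangent:
  assumes v: "v \<in> regular_normal_cone C z"
    and C: "\<forall>\<^sub>F t in at_right 0. z + t *\<^sub>R w + t\<^sup>2 *\<^sub>R b \<in> C"
  shows "v \<bullet> w \<le> 0"
proof -
  have "v \<bullet> w \<le> e * norm w" if "0 < e" for e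
  proof (rule tendsto_le)
    have "\<forall>\<^sub>F p in nhds z. p \<in> C \<longrightarrow> v \<bullet> (p - z) \<le> e * norm (p - z)"
      using v[unfolded regular_normal_cone_iff, rule_format, OF that]
      unfolding eventually_at_filter by (rule eventually_mono) auto
    moreover have "((\<lambda>t. z + t *\<^sub>R w + t\<^sup>2 *\<^sub>R b) \<longlongrightarrow> z) (at_right 0)"
      by (auto intro!: tendsto_eq_intros)
    ultimately have "\<forall>\<^sub>F t in at_right 0. z + t *\<^sub>R w + t\<^sup>2 *\<^sub>R b \<in> C \<longrightarrow>
        v \<bullet> (z + t *\<^sub>R w + t\<^sup>2 *\<^sub>R b - z) \<le> e * norm (z + t *\<^sub>R w + t\<^sup>2 *\<^sub>R b - z)"
      by (rule eventually_compose_filterlim)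
    with C eventually_at_right_less[of 0]
    show "\<forall>\<^sub>F t in at_right 0. v \<bullet> (w + t *\<^sub>R b) \<le> e * norm (w + t *\<^sub>R b)"
    proof eventually_elim
      case (elim t)
      have "z + t *\<^sub>R w + t\<^sup>2 *\<^sub>R b - z = t *\<^sub>R (w + t *\<^sub>R b)"
        by (simp add: algebra_simps power2_eq_square)
      then have "t * (v \<bullet> (w + t *\<^sub>R b)) \<le> t * (e * norm (w + t *\<^sub>R b))"
        using elim by (simp add: mult.left_commute)
      then show ?case
        using elim by simp
    qed
    show "((\<lambda>t. v \<bullet> (w + t *\<^sub>R b)) \<longlongrightarrow> v \<bullet> w) (at_right 0)"
      by (auto intro!: tendsto_eq_intros)
    show "((\<lambda>t. e * norm (w + t *\<^sub>R b)) \<longlongrightarrow> e * norm w) (at_right 0)"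
      by (auto intro!: tendsto_eq_intros)
  qed simp
  then have "\<forall>\<^sub>F e in at_right 0. v \<bullet> w \<le> e * norm w"
    using eventually_at_right_less[of 0] by (auto elim: eventually_mono)
  moreover have "((\<lambda>e. e * norm w) \<longlongrightarrow> 0) (at_right 0)"
    by (auto intro!: tendsto_eq_intros)
  ultimately show ?thesis
    by (intro tendsto_lowerbound) auto
qed

lemma regular_normal_cone_swap:
  fixes C D :: "('a::real_inner \<times> 'a) set"
  assumes "\<And>a b. (a, b) \<in> C \<longleftrightarrow> (b, a) \<in> D"
  shows "(u, v) \<in> regular_normal_cone C (x, y) \<longleftrightarrow> (v, u) \<in> regular_normal_cone D (y, x)"
proof -
  have "(v, u) \<in> regular_normal_cone D (y, x)"
    if D: "\<And>a b. (a, b) \<in> D \<longleftrightarrow> (b, a) \<in> C"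
      and uv: "(u, v) \<in> regular_normal_cone C (x, y)"
    for C D :: "('a \<times> 'a) set" and u v x y
    unfolding regular_normal_cone_iff
  proof (intro allI impI)
    fix e :: real assume "0 < e"
    with uv have "\<forall>\<^sub>F p in at (x, y) within C. (u, v) \<bullet> (p - (x, y)) \<le> e * norm (p - (x, y))"
      by (simp add: regular_normal_cone_iff)
    then have "\<forall>\<^sub>F p in nhds (x, y). p \<noteq> (x, y) \<longrightarrow> p \<in> C \<longrightarrow>
        (u, v) \<bullet> (p - (x, y)) \<le> e * norm (p - (x, y))"
      by (simp add: eventually_at_filter)
    moreover have "filterlim prod.swap (nhds (x, y)) (nhds (y, x))"
      unfolding prod.swap_def by (auto intro!: tendsto_eq_intros filterlim_ident)
    ultimately have "\<forall>\<^sub>F p in nhds (y, x). prod.swap p \<noteq> (x, y) \<longrightarrow> prod.swap p \<in> C \<longrightarrow>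
        (u, v) \<bullet> (prod.swap p - (x, y)) \<le> e * norm (prod.swap p - (x, y))"
      by (rule eventually_compose_filterlim)
    then show "\<forall>\<^sub>F p in at (y, x) within D. (v, u) \<bullet> (p - (y, x)) \<le> e * norm (p - (y, x))"
      unfolding eventually_at_filter
      by (rule eventually_mono) (auto simp: D norm_Pair add.commute)
  qed
  from this[of D C] this[of C D] show ?thesis
    using assms by blast
qed

lemma soc_compl_normal_swap:
  "(u, v) \<in> regular_normal_cone (soc_compl k) (x, y) \<longleftrightarrow>
   (v, u) \<in> regular_normal_cone (soc_compl k) (y, x)"
  by (rule regular_normal_cone_swap) (rule soc_compl_swap)

section \<open>The tangent directions of the boundary\<close>

text \<open>The form of \<open>z + t d\<close> is \<open>t\<^sup>2 (d \<bullet> \<rho> d)\<close>.  Adding a multiple of the null vector \<open>\<rho> z\<close>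
  changes it only through the pairing of \<open>\<rho> (\<rho> z) = z\<close> with \<open>z + t d\<close>, which is the constant \<open>z \<bullet> z\<close>;
  the value of \<open>s\<close> makes the two terms cancel.\<close>
lemma frontier_soc_curve:
  assumes z: "z \<in> frontier (soc k)" "z \<noteq> 0"
    and d: "d \<bullet> z = 0" "d \<bullet> soc_reflect k z = 0"
  defines "s \<equiv> d \<bullet> soc_reflect k d / (2 * (z \<bullet> z))"
  shows "\<forall>\<^sub>F t in at_right 0. z + t *\<^sub>R d + t\<^sup>2 *\<^sub>R (- s *\<^sub>R soc_reflect k z) \<in> frontier (soc k)"
proof -
  let ?p = "\<lambda>t. z + t *\<^sub>R d + t\<^sup>2 *\<^sub>R (- s *\<^sub>R soc_reflect k z)"
  have "?p t \<bullet> soc_reflect k (?p t) = 0" for t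
  proof -
    have "z \<bullet> soc_reflect k z = 0" "z \<bullet> z \<noteq> 0"
      using z by (auto simp: frontier_soc_iff)
    moreover have "soc_reflect k d \<bullet> z = 0" "soc_reflect k d \<bullet> soc_reflect k z = 0"
      using d by (simp_all add: inner_soc_reflect_commute)
    moreover have "s * (2 * (z \<bullet> z)) = d \<bullet> soc_reflect k d"
      using \<open>z \<bullet> z \<noteq> 0\<close> by (simp add: s_def)
    ultimately show ?thesis
      using d
      by (simp add: soc_reflect_linear inner_add_left inner_add_right inner_diff_left inner_diff_right
         inner_commute inner_soc_reflect_commute power2_eq_square algebra_simps)
  qed
  moreover have "\<forall>\<^sub>F t in at_right 0. 0 < ?p t $ k"
  proof (rule order_tendstoD(1))
    show "((\<lambda>t. ?p t $ k) \<longlongrightarrow> z $ k) (at_right 0)"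
      by (auto intro!: tendsto_eq_intros)
    show "0 < z $ k"
      using z soc_head_pos frontier_subset_soc by blast
  qed
  ultimately show ?thesis
    by (auto simp: frontier_soc_iff elim: eventually_mono)
qed

text \<open>The vector obtained from \<open>w\<close> by removing its component along \<open>\<rho> z\<close> is itself one of the
  test directions, and pairing it with \<open>w\<close> gives its squared norm.\<close>
lemma multiple_of_reflect:
  assumes z: "z \<in> frontier (soc k)" "z \<noteq> 0" and w: "w \<bullet> z = 0"
    and d: "\<And>d. d \<bullet> z = 0 \<Longrightarrow> d \<bullet> soc_reflect k z = 0 \<Longrightarrow> w \<bullet> d \<le> 0"
  shows "w = (w \<bullet> soc_reflect k z / (z \<bullet> z)) *\<^sub>R soc_reflect k z"
proof -
  define r where "r = soc_reflect k z"
  define c where "c = w \<bullet> r / (z \<bullet> z)"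
  define d where "d = w - c *\<^sub>R r"
  have r: "r \<bullet> r = z \<bullet> z" "r \<bullet> z = 0" and z0: "z \<bullet> z \<noteq> 0"
    using z by (auto simp: r_def inner_soc_reflect_commute frontier_soc_iff)
  have dz: "d \<bullet> z = 0" and dr: "d \<bullet> r = 0"
    using r w z0 by (simp_all add: d_def c_def inner_diff_left)
  have "d \<bullet> d = w \<bullet> d"
    using dr by (simp add: d_def inner_diff_left inner_diff_right inner_commute)
  also have "\<dots> \<le> 0"
    using assms(4) dz dr by (simp add: r_def)
  finally have "d = 0" by (simp add: inner_self_nonpos)
  then show ?thesis
    by (simp add: d_def c_def r_def)
qed

section \<open>Normal cones at the points of the complementarity set\<close>

lemma regular_normal_cone_origin:
  "regular_normal_cone (soc_compl k) (0, 0) = {(u, v). u \<in> uminus ` soc k \<and> v \<in> uminus ` soc k}"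
    (is "?N = ?R")
proof (rule set_eqI, clarify)
  fix u v
  have "u \<bullet> p \<le> 0" "v \<bullet> p \<le> 0" if "(u, v) \<in> ?N" "p \<in> soc k" for p
  proof -
    have "\<forall>\<^sub>F t in at_right 0. (0, 0) + t *\<^sub>R (p, 0) + t\<^sup>2 *\<^sub>R 0 \<in> soc_compl k"
      and "\<forall>\<^sub>F t in at_right 0. (0, 0) + t *\<^sub>R (0, p) + t\<^sup>2 *\<^sub>R 0 \<in> soc_compl k"
      using eventually_at_right_less[of "0::real"] that(2)
      by (auto elim!: eventually_mono intro!: soc_compl_axes scaleR_in_soc)
    from this[THEN regular_normal_cone_tangent[OF that(1)]] show "u \<bullet> p \<le> 0" "v \<bullet> p \<le> 0"
      by simp_all
  qed
  moreover have "(u, v) \<in> ?N" if "\<forall>p\<in>soc k. u \<bullet> p \<le> 0" "\<forall>p\<in>soc k. v \<bullet> p \<le> 0"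
    using that
    by (intro regular_normal_coneI[where r = "\<lambda>_. 0"])
      (auto simp: eventually_at_filter soc_compl_iff intro!: always_eventually add_nonpos_nonpos)
  moreover have "w \<in> uminus ` soc k \<longleftrightarrow> (\<forall>p\<in>soc k. w \<bullet> p \<le> 0)" for w
    unfolding soc_polar by force
  ultimately show "(u, v) \<in> ?N \<longleftrightarrow> (u, v) \<in> ?R"
    by auto
qed

lemma regular_normal_cone_zero_interior:
  assumes y: "y \<in> interior (soc k)"
  shows "regular_normal_cone (soc_compl k) (0, y) = {(u, v). v = 0}" (is "?N = ?R")
proof (rule set_eqI, clarify)
  fix u v
  have near: "\<forall>\<^sub>F p in nhds y. p \<in> interior (soc k)"
    using y by (intro eventually_nhds_in_open) auto
  have "v = 0" if "(u, v) \<in> ?N"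
  proof -
    have "((\<lambda>t. y + t *\<^sub>R v) \<longlongrightarrow> y) (at_right 0)"
      by (auto intro!: tendsto_eq_intros)
    then have "\<forall>\<^sub>F t in at_right 0. y + t *\<^sub>R v \<in> interior (soc k)"
      using near by (rule eventually_compose_filterlim[rotated])
    then have "\<forall>\<^sub>F t in at_right 0. (0, y) + t *\<^sub>R (0, v) + t\<^sup>2 *\<^sub>R 0 \<in> soc_compl k"
      by (rule eventually_mono) (use interior_subset in \<open>auto intro!: soc_compl_axes\<close>)
    from regular_normal_cone_tangent[OF that this] show ?thesis
      by (simp add: inner_self_nonpos)
  qed
  moreover have "(u, 0) \<in> ?N"
  proof (rule regular_normal_coneI[where r = "\<lambda>_. 0"])
    have "(snd \<longlongrightarrow> y) (at (0, y) within soc_compl k)"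
      by (auto intro!: tendsto_eq_intros)
    then have "\<forall>\<^sub>F p in at (0, y) within soc_compl k. snd p \<in> interior (soc k)"
      using near by (rule eventually_compose_filterlim[rotated])
    moreover have "\<forall>\<^sub>F p in at (0, y) within soc_compl k. p \<in> soc_compl k"
      by (simp add: eventually_at_filter)
    ultimately show "\<forall>\<^sub>F p in at (0, y) within soc_compl k.
        (u, 0) \<bullet> (p - (0, y)) \<le> 0 * norm (p - (0, y))"
      by eventually_elim (auto dest: soc_compl_interior)
  qed simp
  ultimately show "(u, v) \<in> ?N \<longleftrightarrow> (u, v) \<in> ?R"
    by auto
qed

text \<open>The arcs from \<open>(0, y)\<close> into \<open>\<Omega>\<close> either move the first component along \<open>\<rho> y\<close>, or keep it 0 and
  move the second one inside the cone.  The latter bound \<open>v\<close> along \<open>y\<close> (both ways), along \<open>\<rho> y\<close>, and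
  along the remaining tangent directions of the boundary.  Conversely, at a point
  \<open>(a, b) = (s \<rho> b, b)\<close> the term of \<open>v\<close> is nonpositive by self-duality, and that of \<open>u\<close> is at most
  \<open>s (u \<bullet> \<rho> (b - y))\<close>, which is of second order because \<open>s = norm a / norm b\<close>.\<close>
lemma regular_normal_cone_zero_frontier:
  assumes y: "y \<in> frontier (soc k)" "y \<noteq> 0"
  shows "regular_normal_cone (soc_compl k) (0, y) =
    {(u, v). u \<in> vec_polar (soc_reflect k y) \<and> v \<in> nonpos_ray (soc_reflect k y)}" (is "?N = ?R")
proof (rule set_eqI, clarify)
  fix u v
  let ?r = "soc_reflect k y"
  have y_soc: "y \<in> soc k" and r_soc: "?r \<in> soc k" and yr: "y \<bullet> ?r = 0"
    using y by (auto simp: frontier_soc_iff frontier_subset_soc soc_reflect_in_soc)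
  have pos: "\<forall>\<^sub>F t in at_right 0. 0 < t \<and> t < (1::real)"
    using eventually_at_right_real[of 0 "1::real"] by simp
  have "(u, v) \<in> ?R" if N: "(u, v) \<in> ?N"
  proof -
    have "\<forall>\<^sub>F t in at_right 0. (0, y) + t *\<^sub>R (?r, 0) + t\<^sup>2 *\<^sub>R 0 \<in> soc_compl k"
      using pos by eventually_elim
        (use y_soc r_soc yr in \<open>auto simp: soc_compl_iff scaleR_in_soc inner_commute\<close>)
    from regular_normal_cone_tangent[OF N this] have u: "u \<bullet> ?r \<le> 0"
      by simp
    have *: "v \<bullet> d \<le> 0" if "\<forall>\<^sub>F t in at_right 0. y + t *\<^sub>R d + t\<^sup>2 *\<^sub>R b \<in> soc k" for b d
      using regular_normal_cone_tangent[OF N, of "(0, d)" "(0, b)"] that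
      by (simp add: soc_compl_iff zero_in_soc)
    have "\<forall>\<^sub>F t in at_right 0. y + t *\<^sub>R y + t\<^sup>2 *\<^sub>R 0 \<in> soc k"
      using pos by eventually_elim (use y_soc scaleR_in_soc[of y k "1 + _"] in \<open>auto simp: algebra_simps\<close>)
    moreover have "\<forall>\<^sub>F t in at_right 0. y + t *\<^sub>R - y + t\<^sup>2 *\<^sub>R 0 \<in> soc k"
      using pos by eventually_elim (use y_soc scaleR_in_soc[of y k "1 - _"] in \<open>auto simp: algebra_simps\<close>)
    ultimately have vy: "v \<bullet> y = 0"
      using *[of y 0] *[of "- y" 0] by simp
    have "\<forall>\<^sub>F t in at_right 0. y + t *\<^sub>R ?r + t\<^sup>2 *\<^sub>R 0 \<in> soc k"
      using pos
    proof eventually_elim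
      case (elim t)
      have "0 \<le> (y + t *\<^sub>R ?r) \<bullet> soc_reflect k (y + t *\<^sub>R ?r)"
        using elim yr
        by (simp add: soc_reflect_linear inner_add_left inner_add_right
            inner_commute inner_soc_reflect_commute)
      then show ?case
        using elim y_soc by (simp add: soc_iff soc_reflect_nth)
    qed
    then have vr: "v \<bullet> ?r \<le> 0"
      by (rule *)
    have "v \<bullet> d \<le> 0" if "d \<bullet> y = 0" "d \<bullet> ?r = 0" for d
      by (rule *, rule eventually_mono[OF frontier_soc_curve[OF y that]]) (rule frontier_subset_soc)
    from multiple_of_reflect[OF y vy this]
    have "v = (v \<bullet> ?r / (y \<bullet> y)) *\<^sub>R ?r" .
    with vr have "v \<in> nonpos_ray ?r"
      unfolding nonpos_ray_def by (auto intro!: exI[of _ "v \<bullet> ?r / (y \<bullet> y)"] divide_nonpos_nonneg)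
    with u show ?thesis
      by (simp add: vec_polar_def)
  qed
  moreover have "(u, v) \<in> ?N" if R: "(u, v) \<in> ?R"
  proof (rule regular_normal_coneI)
    let ?r1 = "\<lambda>p. norm u * norm (snd p - y) / norm (snd p)"
    have lim: "(snd \<longlongrightarrow> y) (at (0, y) within soc_compl k)"
      by (auto intro!: tendsto_eq_intros)
    show "(?r1 \<longlongrightarrow> 0) (at (0, y) within soc_compl k)"
      using y by (auto intro!: tendsto_eq_intros)
    obtain t where t: "t \<le> 0" "v = t *\<^sub>R ?r" and u: "u \<bullet> ?r \<le> 0"
      using R by (auto simp: nonpos_ray_def vec_polar_def)
    have "\<forall>\<^sub>F p in at (0, y) within soc_compl k. snd p \<noteq> 0"
      using lim y(2) by (rule tendsto_imp_eventually_ne)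
    moreover have "\<forall>\<^sub>F p in at (0, y) within soc_compl k. p \<in> soc_compl k"
      by (simp add: eventually_at_filter)
    ultimately show "\<forall>\<^sub>F p in at (0, y) within soc_compl k.
        (u, v) \<bullet> (p - (0, y)) \<le> ?r1 p * norm (p - (0, y))"
    proof eventually_elim
      case (elim p)
      obtain a b where p: "p = (a, b)" by (cases p)
      define s where "s = a $ k / b $ k"
      have ab: "(a, b) \<in> soc_compl k" and b0: "b \<noteq> 0"
        using elim p by auto
      have a: "a = s *\<^sub>R soc_reflect k b"
        using soc_compl_fst_eq[OF ab b0] by (simp add: s_def)
      have s0: "0 \<le> s"
        using ab by (auto simp: s_def soc_compl_iff soc_iff)
      have na: "s = norm a / norm b"
        using a s0 b0 by simp
      have "v \<bullet> (b - y) = t * (?r \<bullet> b)"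
        using yr t by (simp add: inner_diff_right inner_commute)
      also have "\<dots> \<le> 0"
        using t(1) inner_soc_nonneg[OF r_soc, of b] ab
        by (simp add: soc_compl_iff mult_nonpos_nonneg)
      finally have v: "v \<bullet> (b - y) \<le> 0" .
      have "u \<bullet> a = s * (u \<bullet> ?r) + s * (u \<bullet> soc_reflect k (b - y))"
        by (simp add: a soc_reflect_linear inner_diff_right algebra_simps)
      also have "\<dots> \<le> s * (norm u * norm (b - y))"
        using s0 u norm_cauchy_schwarz[of u "soc_reflect k (b - y)"]
        by (smt (verit) mult_left_mono mult_nonneg_nonpos norm_soc_reflect)
      also have "\<dots> = ?r1 p * norm a"
        by (simp add: na p)
      also have "\<dots> \<le> ?r1 p * norm (p - (0, y))"
        using norm_fst_le[of "a" "b - y"] by (intro mult_left_mono) (auto simp: p)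
      finally show ?case
        using v by (simp add: p)
    qed
  qed
  ultimately show "(u, v) \<in> ?N \<longleftrightarrow> (u, v) \<in> ?R"
    by blast
qed

text \<open>Here \<open>y = c \<rho> x\<close>.  The tangent vectors \<open>(d, c \<rho> d)\<close> pair with \<open>(u, v)\<close> to
  \<open>(u + c \<rho> v) \<bullet> d\<close>, so normality makes \<open>u + c \<rho> v\<close> a multiple of \<open>\<rho> x\<close>; reflecting it and
  multiplying by \<open>x\<^sub>1\<close> gives the condition on \<open>x\<^sub>1 \<rho> u + y\<^sub>1 v\<close>.  Conversely, at \<open>(a, c' \<rho> a)\<close> the pairing is
  the sum of \<open>(c' - c) (v \<bullet> \<rho> (a - x))\<close>, where \<open>c' \<rightarrow> c\<close>, and a multiple of \<open>\<rho> x \<bullet> a\<close>.\<close>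
lemma regular_normal_cone_frontier_frontier:
  assumes xy: "(x, y) \<in> soc_compl k" "x \<noteq> 0" "y \<noteq> 0"
  shows "regular_normal_cone (soc_compl k) (x, y) =
    {(u, v). orthogonal u x \<and> orthogonal v y \<and>
       (x $ k) *\<^sub>R soc_reflect k u + (y $ k) *\<^sub>R v \<in> scalar_line x}" (is "?N = ?R")
proof (rule set_eqI, clarify)
  fix u v
  let ?\<rho> = "soc_reflect k"
  define c where "c = y $ k / x $ k"
  have xk: "0 < x $ k" and yk: "0 < y $ k"
    using xy soc_head_pos by (auto simp: soc_compl_iff)
  then have c0: "0 < c" and ck: "x $ k * c = y $ k"
    by (simp_all add: c_def)
  have y: "y = c *\<^sub>R ?\<rho> x"
    unfolding c_def using xy by (intro soc_compl_snd_eq)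
  have x: "x \<in> frontier (soc k)"
    using xy soc_compl_frontier soc_compl_swap by blast
  then have xx: "x \<bullet> ?\<rho> x = 0"
    by (simp add: frontier_soc_iff)
  have "(u, v) \<in> ?R" if N: "(u, v) \<in> ?N"
  proof -
    have scale: "(a *\<^sub>R x, b *\<^sub>R y) \<in> soc_compl k" if "0 \<le> a" "0 \<le> b" for a b
      using xy that by (simp add: soc_compl_iff scaleR_in_soc)
    have pos: "\<forall>\<^sub>F t in at_right 0. 0 < t \<and> t < (1::real)"
      using eventually_at_right_real[of 0 "1::real"] by simp
    have *: "u \<bullet> (a *\<^sub>R x) + v \<bullet> (b *\<^sub>R y) \<le> 0" if "\<bar>a\<bar> \<le> 1" "\<bar>b\<bar> \<le> 1" for a b
    proof -
      have "\<forall>\<^sub>F t in at_right 0. (x, y) + t *\<^sub>R (a *\<^sub>R x, b *\<^sub>R y) + t\<^sup>2 *\<^sub>R 0 \<in> soc_compl k"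
        using pos
      proof eventually_elim
        case (elim t)
        have "\<bar>t * a\<bar> \<le> 1" "\<bar>t * b\<bar> \<le> 1"
          using elim that by (auto simp: abs_mult intro!: mult_le_one)
        then show ?case
          using scale[of "1 + t * a" "1 + t * b"] by (simp add: algebra_simps abs_le_iff)
      qed
      from regular_normal_cone_tangent[OF N this] show ?thesis
        by simp
    qed
    have ux: "u \<bullet> x = 0" and vy: "v \<bullet> y = 0"
      using *[of 1 0] *[of "-1" 0] *[of 0 1] *[of 0 "-1"] by auto
    define w where "w = u + c *\<^sub>R ?\<rho> v"
    define \<tau> where "\<tau> = w \<bullet> ?\<rho> x / (x \<bullet> x)"
    have "w \<bullet> x = u \<bullet> x + v \<bullet> y"
      by (simp add: w_def y inner_add_left inner_soc_reflect_commute)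
    then have wx: "w \<bullet> x = 0"
      using ux vy by simp
    have "w \<bullet> d \<le> 0" if d: "d \<bullet> x = 0" "d \<bullet> ?\<rho> x = 0" for d
    proof -
      define b where "b = - (d \<bullet> ?\<rho> d / (2 * (x \<bullet> x))) *\<^sub>R ?\<rho> x"
      have "\<forall>\<^sub>F t in at_right 0. x + t *\<^sub>R d + t\<^sup>2 *\<^sub>R b \<in> frontier (soc k)"
        unfolding b_def using x xy(2) d by (rule frontier_soc_curve)
      then have "\<forall>\<^sub>F t in at_right 0.
          (x, y) + t *\<^sub>R (d, c *\<^sub>R ?\<rho> d) + t\<^sup>2 *\<^sub>R (b, c *\<^sub>R ?\<rho> b) \<in> soc_compl k"
      proof eventually_elim
        case (elim t)
        from soc_compl_reflect[OF this, of 1 c] c0 show ?case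
          by (simp add: y soc_reflect_linear algebra_simps)
      qed
      from regular_normal_cone_tangent[OF N this] show ?thesis
        by (simp add: w_def inner_add_left inner_soc_reflect_commute)
    qed
    from multiple_of_reflect[OF x xy(2) wx this] have "w = \<tau> *\<^sub>R ?\<rho> x"
      by (simp add: \<tau>_def)
    then have "?\<rho> w = \<tau> *\<^sub>R x"
      by (simp add: soc_reflect_linear)
    then have "(x $ k) *\<^sub>R ?\<rho> u + (y $ k) *\<^sub>R v = (x $ k * \<tau>) *\<^sub>R x"
      by (simp add: w_def soc_reflect_linear flip: ck scaleR_scaleR scaleR_add_right)
    then show ?thesis
      using ux vy by (auto simp: orthogonal_def scalar_line_def)
  qed
  moreover have "(u, v) \<in> ?N" if R: "(u, v) \<in> ?R"
  proof -
    obtain \<sigma> where \<sigma>: "(x $ k) *\<^sub>R ?\<rho> u + (y $ k) *\<^sub>R v = \<sigma> *\<^sub>R x"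
      using R by (auto simp: scalar_line_def)
    define \<tau> where "\<tau> = \<sigma> / x $ k"
    have "(x $ k) *\<^sub>R (?\<rho> u + c *\<^sub>R v) = (x $ k) *\<^sub>R (\<tau> *\<^sub>R x)"
      using \<sigma> xk by (simp add: \<tau>_def scaleR_add_right ck)
    then have "?\<rho> u + c *\<^sub>R v = \<tau> *\<^sub>R x"
      by (rule scaleR_left_imp_eq[rotated]) (use xk in simp)
    then have "?\<rho> (?\<rho> u + c *\<^sub>R v) = \<tau> *\<^sub>R ?\<rho> x"
      by (simp add: soc_reflect_linear)
    then have u: "u = \<tau> *\<^sub>R ?\<rho> x - c *\<^sub>R ?\<rho> v"
      by (simp add: soc_reflect_linear algebra_simps)
    have vx: "v \<bullet> ?\<rho> x = 0"
      using R c0 by (simp add: orthogonal_def y)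
    let ?r = "\<lambda>p. \<bar>snd p $ k / fst p $ k - c\<bar> * norm v + \<bar>\<tau>\<bar> / 2 * norm (fst p - x)"
    let ?F = "at (x, y) within soc_compl k"
    have lim: "(fst \<longlongrightarrow> x) ?F" "(snd \<longlongrightarrow> y) ?F"
      by (auto intro!: tendsto_eq_intros)
    show ?thesis
    proof (rule regular_normal_coneI)
      show "(?r \<longlongrightarrow> 0) ?F"
        using xk by (auto intro!: tendsto_eq_intros simp: c_def)
      have "\<forall>\<^sub>F p in ?F. fst p \<noteq> 0" "\<forall>\<^sub>F p in ?F. snd p \<noteq> 0"
        using lim xy(2,3) by (auto intro: tendsto_imp_eventually_ne)
      moreover have "\<forall>\<^sub>F p in ?F. p \<in> soc_compl k"
        by (simp add: eventually_at_filter)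
      ultimately show "\<forall>\<^sub>F p in ?F. (u, v) \<bullet> (p - (x, y)) \<le> ?r p * norm (p - (x, y))"
      proof eventually_elim
        case (elim p)
        obtain a b where p: "p = (a, b)" by (cases p)
        define c' where "c' = b $ k / a $ k"
        have ab: "(a, b) \<in> soc_compl k" "a \<noteq> 0" "b \<noteq> 0"
          using elim p by auto
        have b: "b = c' *\<^sub>R ?\<rho> a"
          unfolding c'_def using ab by (intro soc_compl_snd_eq)
        have "a \<in> frontier (soc k)"
          using ab soc_compl_frontier soc_compl_swap by blast
        then have aa: "a \<bullet> ?\<rho> a = 0"
          by (simp add: frontier_soc_iff)
        have comm: "a \<bullet> ?\<rho> x = x \<bullet> ?\<rho> a"
          by (metis inner_commute inner_soc_reflect_commute)
        \<comment> \<open>Expanding the Lorentz form of \<open>a - x\<close> kills both squares, since \<open>a\<close> and \<open>x\<close> are null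
          vectors: the term of \<open>u\<close> along the reflection of \<open>x\<close> is therefore of second order.\<close>
        have quad: "?\<rho> x \<bullet> a = - ((a - x) \<bullet> ?\<rho> (a - x)) / 2"
          using xx aa comm
          by (simp add: soc_reflect_linear inner_diff_left inner_diff_right inner_commute
              inner_soc_reflect_commute)
        have "(u, v) \<bullet> (p - (x, y)) = (c' - c) * (v \<bullet> ?\<rho> (a - x)) + \<tau> * (?\<rho> x \<bullet> a)"
          using xx vx
          by (simp add: p b y u soc_reflect_linear inner_diff_left inner_diff_right
              inner_soc_reflect_commute algebra_simps)
        also have "\<dots> \<le> \<bar>c' - c\<bar> * (norm v * norm (a - x)) + \<bar>\<tau>\<bar> * ((norm (a - x))\<^sup>2 / 2)"
        proof (rule add_mono)
          have "\<bar>v \<bullet> ?\<rho> (a - x)\<bar> \<le> norm v * norm (a - x)"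
            using Cauchy_Schwarz_ineq2[of v "?\<rho> (a - x)"] by simp
          then show "(c' - c) * (v \<bullet> ?\<rho> (a - x)) \<le> \<bar>c' - c\<bar> * (norm v * norm (a - x))"
            by (rule mult_le_abs_mult)
          have "\<bar>?\<rho> x \<bullet> a\<bar> \<le> (norm (a - x))\<^sup>2 / 2"
            using Cauchy_Schwarz_ineq2[of "a - x" "?\<rho> (a - x)"]
            by (simp add: quad power2_eq_square)
          then show "\<tau> * (?\<rho> x \<bullet> a) \<le> \<bar>\<tau>\<bar> * ((norm (a - x))\<^sup>2 / 2)"
            by (rule mult_le_abs_mult)
        qed
        also have "\<dots> = ?r p * norm (a - x)"
          by (simp add: p c'_def algebra_simps power2_eq_square)
        also have "\<dots> \<le> ?r p * norm (p - (x, y))"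
          using norm_fst_le[of "a - x" "b - y"] by (intro mult_left_mono) (auto simp: p)
        finally show ?case .
      qed
    qed
  qed
  ultimately show "(u, v) \<in> ?N \<longleftrightarrow> (u, v) \<in> ?R"
    by blast
qed

theorem theorem3p1:
  fixes k :: "'m::finite" and x y :: "real ^ 'm"
  assumes "(x, y) \<in> soc_compl k"
  shows "(x = 0 \<and> y \<in> interior (soc k) \<longrightarrow>
           regular_normal_cone (soc_compl k) (x, y) = {(u, v). v = 0})
       \<and> (x \<in> interior (soc k) \<and> y = 0 \<longrightarrow>
           regular_normal_cone (soc_compl k) (x, y) = {(u, v). u = 0})
       \<and> (x \<in> frontier (soc k) - {0} \<and> y \<in> frontier (soc k) - {0} \<and> x \<bullet> y = 0 \<longrightarrow>
           regular_normal_cone (soc_compl k) (x, y) =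
             {(u, v). orthogonal u x \<and> orthogonal v y \<and>
                (x $ k) *\<^sub>R soc_reflect k u + (y $ k) *\<^sub>R v \<in> scalar_line x})
       \<and> (x = 0 \<and> y \<in> frontier (soc k) - {0} \<longrightarrow>
           regular_normal_cone (soc_compl k) (x, y) =
             {(u, v). u \<in> vec_polar (soc_reflect k y) \<and> v \<in> nonpos_ray (soc_reflect k y)})
       \<and> (x \<in> frontier (soc k) - {0} \<and> y = 0 \<longrightarrow>
           regular_normal_cone (soc_compl k) (x, y) =
             {(u, v). u \<in> nonpos_ray (soc_reflect k x) \<and> v \<in> vec_polar (soc_reflect k x)})
       \<and> (x = 0 \<and> y = 0 \<longrightarrow>
           regular_normal_cone (soc_compl k) (x, y) =
             {(u, v). u \<in> uminus ` soc k \<and> v \<in> uminus ` soc k})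
       \<and> ((x = 0 \<and> y \<in> interior (soc k)) \<or> (x \<in> interior (soc k) \<and> y = 0)
          \<or> (x \<in> frontier (soc k) - {0} \<and> y \<in> frontier (soc k) - {0} \<and> x \<bullet> y = 0)
          \<or> (x = 0 \<and> y \<in> frontier (soc k) - {0}) \<or> (x \<in> frontier (soc k) - {0} \<and> y = 0)
          \<or> (x = 0 \<and> y = 0))"
proof (intro conjI impI, goal_cases)
  case 1
  then show ?case
    using regular_normal_cone_zero_interior by auto
next
  case 2
  then show ?case
    using regular_normal_cone_zero_interior[of x k] soc_compl_normal_swap[of _ _ k x y] by auto
next
  case 3
  then show ?case
    using assms by (intro regular_normal_cone_frontier_frontier) auto
next
  case 4
  then show ?case
    using regular_normal_cone_zero_frontier[of y k] by simp
next
  case 5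
  then show ?case
    using regular_normal_cone_zero_frontier[of x k] soc_compl_normal_swap[of _ _ k x y] by auto
next
  case 6
  then show ?case
    using regular_normal_cone_origin[of k] by simp
next
  case 7
  have "x = 0 \<or> y = 0 \<or> x \<in> frontier (soc k) \<and> y \<in> frontier (soc k)"
    using assms soc_compl_frontier soc_compl_swap by blast
  then show ?case
    using assms soc_interior_or_frontier[of x k] soc_interior_or_frontier[of y k]
    by (auto simp: soc_compl_iff)
qed

end
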